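(* Assume that the disturbance $d_t$ is deterministic and periodic with known period $T>0$, and that for each given $\alpha$ the stage cost $\ell(\alpha,\cdot)$ is continuous and strictly convex. Consider the $T$-step EMPC problem for the lifted system. Then the closed-loop solution $(\tilde x_t,\tilde u_t)$, $\tilde u_t=\tilde u_{0|t}$, given by the $T$-step EMPC (started from a feasible initial lifted state) asymptotically converges to $\tilde{\mathcal{Z}}^s$, i.e. its Euclidean distance to $\tilde{\mathcal{Z}}^s$ tends to $0$. Consequently, $\tilde\ell(\tilde\alpha,\tilde u_t)\to\tilde\ell^s$ as $t\to\infty$.
   Context: Setting. $x_{t+1}=Ax_t+Bu_t+B_dd_t$ with $x_t\in\mathcal{X}\subseteq\mathbb{R}^n$, $u_t\in\mathcal{U}\subseteq\mathbb{R}^m$, $\mathcal{X},\mathcal{U}$ compact and convex, $T\ge 1$ an integer, $d_t=d_{[t]_T}$ where $[t]_T$ is the remainder of $t$ modulo $T$. The stage cost is $\ell(\alpha_{[t]_T},u_t)$, where $\alpha_t$ is a given $T$-periodic external variable. Lifted system: $\tilde x_{t+1}=[x_{tT+1}^\top,\dots,x_{(t+1)T}^\top]^\top$, $\tilde u_t=[u_{tT}^\top,\dots,u_{(t+1)T-1}^\top]^\top$, $\tilde d=[d_0^\top,\dots,d_{T-1}^\top]^\top$, $\tilde\alpha=[\alpha_0^\top,\dots,\alpha_{T-1}^\top]^\top$, and $\tilde x_{t+1}=\tilde A\tilde x_t+\tilde B_u\tilde u_t+\tilde B_d\tilde d$, where $\tilde A$ is the $T\times T$ block matrix whose last block column is $(A,A^2,\dots,A^T)$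 (top to bottom) and whose other blocks are zero; $\tilde B_u$ is the block lower triangular matrix with $(i,j)$ block $A^{i-j}B$ for $i\ge j$ and $0$ otherwise; $\tilde B_d$ is the same with $B_d$ in place of $B$. $\tilde{\mathcal{X}}=\mathcal{X}^T$, $\tilde{\mathcal{U}}=\mathcal{U}^T$, $\tilde\ell(\tilde\alpha,\tilde u)=\sum_{t=0}^{T-1}\ell(\alpha_t,u_t)$ for $\tilde u=[u_0^\top,\dots,u_{T-1}^\top]^\top$. Lifted steady-state problem: minimise $\tilde\ell(\tilde\alpha,\tilde u)$ over $(\tilde x,\tilde u)\in\tilde{\mathcal{X}}\times\tilde{\mathcal{U}}$ subject to $\tilde x=\tilde A\tilde x+\tilde B_u\tilde u+\tilde B_d\tilde d$. It is assumed that it has a solution and that strong duality holds for it (primal and dual optimal values coincide, with the dual attained). Its optimal value is $\tilde\ell^s$, its (unique) optimal input is $\tilde u^s$, and $\tilde{\mathcal{Z}}^s=\{(\tilde x,\tilde u^s)\in\tilde{\mathcal{X}}\times\tilde{\mathcal{U}}:\tilde x=\tilde A\tilde x+\tilde B_u\tilde u^s+\tilde B_d\tilde d,\ \tilde\ell(\tilde\alpha,\tilde u^s)=\tilde\ell^s\}$, $\tilde{\mathcal{X}}^s=\{\tilde x\in\tilde{\mathcal X}:\exists\tilde u\in\tilde{\mathcal{U}},(\tilde x,\tilde u)\in\tilde{\mathcal{Z}}^s\}$. $T$-step EMPC problem at lifted state $\tilde x_t$ (integer $K>1$, horizon $N=KT$): minimise $\sum_{i=0}^{K-1}\tilde\ell(\tilde\alpha,\tilde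 u_{i|t})$ over $\tilde u_{0|t},\dots,\tilde u_{K-1|t}$ subject to $\tilde x_{0|t}=\tilde x_t$ and, for $i=0,\dots,K-1$, $\tilde x_{i+1|t}=\tilde A\tilde x_{i|t}+\tilde B_u\tilde u_{i|t}+\tilde B_d\tilde d$, $\tilde x_{i|t}\in\tilde{\mathcal{X}}$, $\tilde u_{i|t}\in\tilde{\mathcal{U}}$, and $\tilde x_{K|t}\in\tilde{\mathcal{X}}^s$. In closed loop, $\tilde u_t=\tilde u_{0|t}$ from an optimal solution is applied: $\tilde x_{t+1}=\tilde A\tilde x_t+\tilde B_u\tilde u_{0|t}+\tilde B_d\tilde d$. *)

theory Defs
  imports "HOL-Analysis.Analysis"
begin

section \<open>Stacked vectors and block matrices\<close>

text \<open>
  The period is the cardinality of a finite linearly ordered type 't, whose elements index the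
  blocks of a stacked vector. Blocks are numbered from 0 in increasing order by \<open>idx\<close>, so that
  \<open>idx\<close> is a bijection onto \<open>{..<CARD('t)}\<close>. The space of T stacked vectors of dimension n is
  the Euclidean space \<open>real ^ ('t \<times> 'n)\<close>.
\<close>

definition idx :: "'t::{finite,linorder} \<Rightarrow> nat" where
  "idx i = card {j. j < i}"

lemma idx_less_iff: "idx i < idx j \<longleftrightarrow> i < j"
proof -
  have "idx i < idx j" if "i < j" for i j :: "'a"
    unfolding idx_def using that by (intro psubset_card_mono) auto
  then show ?thesis by (metis linorder_neqE order_less_imp_not_less order_less_irrefl)
qed

lemma idx_less_card: "idx (i :: 't::{finite,linorder}) < CARD('t)"
  unfolding idx_def by (intro psubset_card_mono) auto

lemma idx_inj: "inj idx"
  by (metis idx_less_iff injI linorder_neqE order_less_irrefl)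

lemma idx_range: "range (idx :: 't::{finite,linorder} \<Rightarrow> nat) = {..<CARD('t)}"
  by (rule card_subset_eq) (auto simp: idx_less_card card_image idx_inj)

lemma idx_atMost: "idx ` {..i} = {..idx i}"
proof
  show "idx ` {..i} \<subseteq> {..idx i}" by (auto simp: idx_less_iff simp flip: not_less)
  show "{..idx i} \<subseteq> idx ` {..i}"
  proof
    fix k assume k: "k \<in> {..idx i}"
    then have "k \<in> range (idx :: 'a \<Rightarrow> nat)"
      using idx_less_card[of i] by (auto simp: idx_range)
    then show "k \<in> idx ` {..i}"
      using k by (auto simp: idx_less_iff simp flip: not_less)
  qed
qed

definition stack :: "('t::finite \<Rightarrow> real ^ 'n) \<Rightarrow> real ^ ('t \<times> 'n)" where
  "stack f = (\<chi> r. f (fst r) $ snd r)"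

definition block :: "real ^ ('t \<times> 'n) \<Rightarrow> 't::finite \<Rightarrow> real ^ 'n" where
  "block v i = (\<chi> p. v $ (i, p))"

definition block_matrix ::
    "('t::finite \<Rightarrow> 's::finite \<Rightarrow> real ^ 'k ^ 'n) \<Rightarrow> real ^ ('s \<times> 'k) ^ ('t \<times> 'n)" where
  "block_matrix M = (\<chi> r c. M (fst r) (fst c) $ snd r $ snd c)"

lemma block_stack [simp]: "block (stack g) i = g i"
  by (simp add: block_def stack_def vec_eq_iff)

lemma stack_block [simp]: "stack (block v) = v"
  by (simp add: block_def stack_def vec_eq_iff)

lemma block_matrix_mult: "block (block_matrix M *v v) i = (\<Sum>j\<in>UNIV. M i j *v block v j)"
  by (simp add: block_def block_matrix_def vec_eq_iff matrix_vector_mult_def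
      sum.cartesian_product UNIV_Times_UNIV [symmetric] split_def del: UNIV_Times_UNIV)

text \<open>The type class power \<open>A ^ k\<close> is the componentwise one for vectors, hence this definition.\<close>

primrec matpow :: "real ^ 'n ^ 'n \<Rightarrow> nat \<Rightarrow> real ^ 'n ^ 'n" where
  "matpow A 0 = mat 1"
| "matpow A (Suc k) = A ** matpow A k"


section \<open>Lifted system\<close>

definition periodic :: "nat \<Rightarrow> (nat \<Rightarrow> 'a) \<Rightarrow> bool" where
  "periodic T s \<longleftrightarrow> (\<forall>t. s t = s (t mod T))"

definition lift_signal :: "(nat \<Rightarrow> real ^ 'd) \<Rightarrow> real ^ ('t::{finite,linorder} \<times> 'd)" where
  "lift_signal s = stack (\<lambda>i. s (idx i))"

text \<open>As \<open>idx\<close> starts at 0, the block row i of the last block column holds the power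
  \<open>idx i + 1\<close> of A.\<close>

definition lift_A ::
    "real ^ 'n ^ 'n \<Rightarrow> real ^ ('t \<times> 'n) ^ ('t::{finite,linorder} \<times> 'n)" where
  "lift_A A = block_matrix
     (\<lambda>i j. if Suc (idx j) = CARD('t) then matpow A (Suc (idx i)) else 0)"

definition lift_B ::
    "real ^ 'n ^ 'n \<Rightarrow> real ^ 'm ^ 'n \<Rightarrow> real ^ ('t \<times> 'm) ^ ('t::{finite,linorder} \<times> 'n)" where
  "lift_B A B = block_matrix (\<lambda>i j. if j \<le> i then matpow A (idx i - idx j) ** B else 0)"

definition lift_step ::
    "real ^ 'n ^ 'n \<Rightarrow> real ^ 'm ^ 'n \<Rightarrow> real ^ 'd ^ 'n \<Rightarrow> real ^ ('t \<times> 'd) \<Rightarrow>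
     real ^ ('t \<times> 'n) \<Rightarrow> real ^ ('t \<times> 'm) \<Rightarrow> real ^ ('t::{finite,linorder} \<times> 'n)" where
  "lift_step A B Bd d x u = lift_A A *v x + lift_B A B *v u + lift_B A Bd *v d"

lemma lift_A_mult:
  fixes v :: "real ^ ('t::{finite,linorder} \<times> 'n::finite)"
  assumes "Suc (idx m) = CARD('t)"
  shows "block (lift_A A *v v) i = matpow A (Suc (idx i)) *v block v m"
proof -
  have "Suc (idx j) = CARD('t) \<longleftrightarrow> j = m" for j
    using assms injD[OF idx_inj, of j m] by auto
  then show ?thesis
    by (simp add: lift_A_def block_matrix_mult if_distrib[of "\<lambda>M. M *v _"] cong: if_cong)
qed

lemma lift_B_mult: 
  "block (lift_B A B *v stack (\<lambda>i. w (idx i))) i =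
   (\<Sum>k\<le>idx i. matpow A (idx i - k) *v (B *v w k))"
proof -
  have "block (lift_B A B *v stack (\<lambda>i. w (idx i))) i =
      (\<Sum>j\<in>{..i}. matpow A (idx i - idx j) *v (B *v w (idx j)))"
    by (simp add: lift_B_def block_matrix_mult if_distrib[of "\<lambda>M. M *v _"] sum.If_cases 
       atMost_def matrix_vector_mul_assoc cong: if_cong)
  also have "\<dots> = (\<Sum>k\<in>idx ` {..i}. matpow A (idx i - k) *v (B *v w k))"
    by (subst sum.reindex) (auto intro: inj_on_subset[OF idx_inj])
  finally show ?thesis by (simp add: idx_atMost)
qed

lemma state_unroll:
  assumes "\<And>k. x (Suc k) = A *v x k + B *v u k + Bd *v d k"
  shows "x (Suc (s + j)) = matpow A (Suc j) *v x s +
    (\<Sum>k\<le>j. matpow A (j - k) *v (B *v u (s + k))) + (\<Sum>k\<le>j. matpow A (j - k) *v (Bd *v d (s + k)))"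
proof (induction j)
  case (Suc j)
  have *: "A *v (\<Sum>k\<le>j. matpow A (j - k) *v w k) = (\<Sum>k\<le>j. matpow A (Suc j - k) *v w k)" for w
    by (simp add: matrix_vector_mul_assoc Suc_diff_le linear_sum[OF matrix_vector_mul_linear])
  show ?case
    using assms[of "Suc (s + j)"] Suc *[of "\<lambda>k. B *v u (s + k)"] *[of "\<lambda>k. Bd *v d (s + k)"]
    by (simp add: matrix_vector_right_distrib matrix_vector_mul_assoc)
qed (simp add: assms)

text \<open>
  The lifted transition map reproduces the original recursion over one period. The lifted state is
  made of the states at times t T + 1, ..., (t + 1) T, while the input of the next lifted step
  consists of the inputs at times (t + 1) T, ..., (t + 2) T - 1.
\<close>

lemma lift_step_signal:
  fixes x :: "nat \<Rightarrow> real ^ 'n" and d :: "nat \<Rightarrow> real ^ 'd"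
  defines "T \<equiv> CARD('t::{finite,linorder})"
  assumes dyn: "\<And>k. x (Suc k) = A *v x k + B *v u k + Bd *v d k"
    and per: "periodic T d"
  shows "stack (\<lambda>i::'t. x (Suc t * T + idx i + 1)) =
    lift_step A B Bd (lift_signal d) (stack (\<lambda>i. x (t * T + idx i + 1)))
      (stack (\<lambda>i. u (Suc t * T + idx i)))"
proof -
  have "T - 1 \<in> range (idx :: 't \<Rightarrow> nat)" by (simp add: idx_range T_def)
  then obtain m :: 't where m: "Suc (idx m) = CARD('t)"
    by (metis T_def Suc_pred' rangeE zero_less_card_finite)
  have m': "t * T + idx m + 1 = Suc t * T" using m by (simp add: T_def)
  have d: "d (Suc t * T + k) = d k" for k
    using per unfolding periodic_def by (metis mod_mult_self3 add.commute)
  have "block (lift_step A B Bd (lift_signal d) (stack (\<lambda>i. x (t * T + idx i + 1)))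
      (stack (\<lambda>i. u (Suc t * T + idx i)))) i = x (Suc t * T + idx i + 1)" for i :: 't
  proof -
    have bp: "block (a + b) i = block a i + block b i" for a b :: "real ^ ('t \<times> 'n::finite)"
      by (simp add: block_def vec_eq_iff)
    show ?thesis
      using state_unroll[of x A B u Bd d "Suc t * T" "idx i", OF dyn]
      unfolding lift_step_def lift_signal_def bp lift_B_mult lift_A_mult[OF m]
        lift_B_mult[where w = "\<lambda>k. u (Suc t * T + k)"] block_stack m' d
      by (simp add: ac_simps)
  qed
  then show ?thesis by (metis (no_types, lifting) stack_block ext)
qed

definition lift_set :: "(real ^ 'n) set \<Rightarrow> (real ^ ('t::finite \<times> 'n)) set" where
  "lift_set S = {v. \<forall>i. block v i \<in> S}"

definition lift_cost ::
    "(real ^ 'p \<Rightarrow> real ^ 'm \<Rightarrow> real) \<Rightarrow> real ^ ('t \<times> 'p) \<Rightarrow> real ^ ('t::finite \<times> 'm) \<Rightarrow> real" where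
  "lift_cost l a u = (\<Sum>i\<in>UNIV. l (block a i) (block u i))"

definition strictly_convex_on :: "'a::real_vector set \<Rightarrow> ('a \<Rightarrow> real) \<Rightarrow> bool" where
  "strictly_convex_on S f \<longleftrightarrow> convex S \<and>
     (\<forall>x\<in>S. \<forall>y\<in>S. \<forall>s. x \<noteq> y \<and> 0 < s \<and> s < 1 \<longrightarrow>
        f ((1 - s) *\<^sub>R x + s *\<^sub>R y) < (1 - s) * f x + s * f y)"


section \<open>Steady-state problem\<close>

text \<open>
  In this and the next section f is the (lifted) transition map, X and U are the state and input
  constraint sets and c is the (lifted) stage cost as a function of the input.
\<close>

definition steady_feasible ::
    "('x \<Rightarrow> 'u \<Rightarrow> 'x) \<Rightarrow> 'x set \<Rightarrow> 'u set \<Rightarrow> ('x \<times> 'u) set" where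
  "steady_feasible f X U = {(x, u). x \<in> X \<and> u \<in> U \<and> x = f x u}"

definition steady_solution ::
    "('x \<Rightarrow> 'u \<Rightarrow> 'x) \<Rightarrow> 'x set \<Rightarrow> 'u set \<Rightarrow> ('u \<Rightarrow> real) \<Rightarrow> 'x \<Rightarrow> 'u \<Rightarrow> bool" where
  "steady_solution f X U c x u \<longleftrightarrow> (x, u) \<in> steady_feasible f X U \<and>
     (\<forall>(x', u') \<in> steady_feasible f X U. c u \<le> c u')"

definition steady_value ::
    "('x \<Rightarrow> 'u \<Rightarrow> 'x) \<Rightarrow> 'x set \<Rightarrow> 'u set \<Rightarrow> ('u \<Rightarrow> real) \<Rightarrow> real" where
  "steady_value f X U c = (INF (x, u) \<in> steady_feasible f X U. c u)"

text \<open>The optimal input is unique if f is affine, X is convex and c is strictly convex on U.\<close>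

definition steady_input ::
    "('x \<Rightarrow> 'u \<Rightarrow> 'x) \<Rightarrow> 'x set \<Rightarrow> 'u set \<Rightarrow> ('u \<Rightarrow> real) \<Rightarrow> 'u" where
  "steady_input f X U c = (THE u. \<exists>x. steady_solution f X U c x u)"

definition steady_set ::
    "('x \<Rightarrow> 'u \<Rightarrow> 'x) \<Rightarrow> 'x set \<Rightarrow> 'u set \<Rightarrow> ('u \<Rightarrow> real) \<Rightarrow> ('x \<times> 'u) set" where
  "steady_set f X U c = {(x, u). x \<in> X \<and> u \<in> U \<and> u = steady_input f X U c \<and> x = f x u \<and>
     c u = steady_value f X U c}"

definition steady_states ::
    "('x \<Rightarrow> 'u \<Rightarrow> 'x) \<Rightarrow> 'x set \<Rightarrow> 'u set \<Rightarrow> ('u \<Rightarrow> real) \<Rightarrow> 'x set" where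
  "steady_states f X U c = {x \<in> X. \<exists>u\<in>U. (x, u) \<in> steady_set f X U c}"

text \<open>
  Lagrangian duality with a multiplier for the steady-state equation only; the constraints
  \<open>x \<in> X\<close> and \<open>u \<in> U\<close> stay explicit in the Lagrangian minimisation.
\<close>

definition steady_dual_fun ::
    "('x::real_inner \<Rightarrow> 'u \<Rightarrow> 'x) \<Rightarrow> 'x set \<Rightarrow> 'u set \<Rightarrow> ('u \<Rightarrow> real) \<Rightarrow> 'x \<Rightarrow> ereal" where
  "steady_dual_fun f X U c y = (INF (x, u) \<in> X \<times> U. ereal (c u + y \<bullet> (x - f x u)))"

definition steady_strong_duality ::
    "('x::real_inner \<Rightarrow> 'u \<Rightarrow> 'x) \<Rightarrow> 'x set \<Rightarrow> 'u set \<Rightarrow> ('u \<Rightarrow> real) \<Rightarrow> bool" where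
  "steady_strong_duality f X U c \<longleftrightarrow>
     ereal (steady_value f X U c) = (SUP y. steady_dual_fun f X U c y) \<and>
     (\<exists>y. steady_dual_fun f X U c y = (SUP y'. steady_dual_fun f X U c y'))"


section \<open>Model predictive control with terminal set\<close>

primrec predict :: "('x \<Rightarrow> 'u \<Rightarrow> 'x) \<Rightarrow> 'x \<Rightarrow> (nat \<Rightarrow> 'u) \<Rightarrow> nat \<Rightarrow> 'x" where
  "predict f x v 0 = x"
| "predict f x v (Suc i) = f (predict f x v i) (v i)"

definition mpc_feasible ::
    "('x \<Rightarrow> 'u \<Rightarrow> 'x) \<Rightarrow> 'x set \<Rightarrow> 'u set \<Rightarrow> 'x set \<Rightarrow> nat \<Rightarrow> 'x \<Rightarrow> (nat \<Rightarrow> 'u) \<Rightarrow> bool" where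
  "mpc_feasible f X U Xf K x v \<longleftrightarrow>
     (\<forall>i<K. predict f x v i \<in> X \<and> v i \<in> U) \<and> predict f x v K \<in> Xf"

definition mpc_optimal ::
    "('x \<Rightarrow> 'u \<Rightarrow> 'x) \<Rightarrow> 'x set \<Rightarrow> 'u set \<Rightarrow> ('u \<Rightarrow> real) \<Rightarrow> 'x set \<Rightarrow> nat \<Rightarrow> 'x \<Rightarrow> (nat \<Rightarrow> 'u) \<Rightarrow> bool"
  where
  "mpc_optimal f X U c Xf K x v \<longleftrightarrow> mpc_feasible f X U Xf K x v \<and>
     (\<forall>w. mpc_feasible f X U Xf K x w \<longrightarrow> (\<Sum>i<K. c (v i)) \<le> (\<Sum>i<K. c (w i)))"

text \<open>
  The input at time t is required to come from an optimal solution only if there is one. So being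
  a closed loop does not presuppose that the optimisation problems stay feasible along it, or that
  their minima are attained.
\<close>

definition closed_loop ::
    "('x \<Rightarrow> 'u \<Rightarrow> 'x) \<Rightarrow> 'x set \<Rightarrow> 'u set \<Rightarrow> ('u \<Rightarrow> real) \<Rightarrow> 'x set \<Rightarrow> nat \<Rightarrow>
     (nat \<Rightarrow> 'x) \<Rightarrow> (nat \<Rightarrow> 'u) \<Rightarrow> bool" where
  "closed_loop f X U c Xf K x u \<longleftrightarrow>
     (\<forall>t. x (Suc t) = f (x t) (u t)) \<and>
     (\<forall>t. (\<exists>v. mpc_optimal f X U c Xf K (x t) v) \<longrightarrow>
          (\<exists>v. mpc_optimal f X U c Xf K (x t) v \<and> u t = v 0))"

end

theory Submission
  imports Defs
begin

text \<open>
  A dual solution y makes \<open>x \<mapsto> y \<bullet> x\<close> a storage function, so the optimal value plus \<open>y \<bullet> x\<close> is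
  bounded below and does not increase along the closed loop. Hence the shifted prediction, extended
  by the steady input, becomes asymptotically optimal for the next problem, and strict convexity
  forces it to approach the optimal prediction. Backwards in the horizon, every predicted input
  then tends to the steady input. So the state K steps later approaches the predicted terminal
  state, which is steady.

  The zeros of the rotated stage cost need not be steady states (they only fix the input), so the
  convergence of the states really uses the terminal constraint.
\<close>

section \<open>Compactness and strict convexity\<close>

text \<open>Tychonoff's theorem, stated for the function type. The index type is arbitrary, so it
  serves both infinite input sequences and finite families of blocks.\<close>

lemma compact_Pi_UNIV:
  fixes S :: "'i \<Rightarrow> 'a::topological_space set"
  assumes "\<And>i. compact (S i)"
  shows "compact (Pi UNIV S)"
proof -
  have "compactin (product_topology (\<lambda>_. euclidean) UNIV) (PiE UNIV S)"
    using assms by (subst compactin_PiE) auto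
  then show ?thesis
    by (simp add: euclidean_product_topology PiE_UNIV_domain Pi_def)
qed

text \<open>The part of \<open>C\<close> where \<open>h\<close> is at least \<open>a\<close> is
  compact and contains no zero of \<open>g\<close>. So \<open>g\<close> has a positive minimum
  there, and once \<open>g (z t)\<close> falls below it, \<open>z t\<close> has left that
  part.\<close>

lemma compact_nonneg_tendsto_zero:
  fixes g h :: "'a::t2_space \<Rightarrow> real"
  assumes C: "compact C" and g: "continuous_on C g" and h: "continuous_on C h"
    and g0: "\<And>z. z \<in> C \<Longrightarrow> 0 \<le> g z" and h0: "\<And>z. z \<in> C \<Longrightarrow> 0 \<le> h z"
    and gh: "\<And>z. z \<in> C \<Longrightarrow> g z = 0 \<Longrightarrow> h z = 0"
    and z: "\<And>t. z t \<in> C" and lim: "((\<lambda>t. g (z t)) \<longlongrightarrow> 0) Fl"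
  shows "((\<lambda>t. h (z t)) \<longlongrightarrow> 0) Fl"
proof (rule order_tendstoI)
  fix a :: real assume "a < 0"
  then show "\<forall>\<^sub>F t in Fl. a < h (z t)"
    by (intro always_eventually allI order.strict_trans2[OF _ h0[OF z]])
next
  fix a :: real assume a: "0 < a"
  define D where "D = {w \<in> C. a \<le> h w}"
  have "D = C \<inter> h -` {a..}" by (auto simp: D_def)
  moreover have "closedin (top_of_set C) (C \<inter> h -` {a..})"
    using h by (rule continuous_closedin_preimage) simp
  ultimately have D: "compact D"
    using C closedin_compact by metis
  show "\<forall>\<^sub>F t in Fl. h (z t) < a"
  proof (cases "D = {}")
    case True
    then have "h (z t) < a" for t
      using z[of t] by (auto simp: D_def not_le)
    then show ?thesis by simp
  next
    case False
    then obtain m where m: "m \<in> D" "\<And>w. w \<in> D \<Longrightarrow> g m \<le> g w"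
      using continuous_attains_inf[OF D] continuous_on_subset[OF g, of D] D_def by blast
    then have "g m \<noteq> 0" "0 \<le> g m"
      using a g0 gh by (fastforce simp: D_def)+
    then have "\<forall>\<^sub>F t in Fl. g (z t) < g m"
      using lim by (intro order_tendstoD) auto
    then show ?thesis
      by eventually_elim (metis (mono_tags, lifting) D_def m(2) mem_Collect_eq not_le z)
  qed
qed

lemma convex_midpoint: "convex S \<Longrightarrow> a \<in> S \<Longrightarrow> b \<in> S \<Longrightarrow> midpoint a b \<in> S"
  using closed_segment_subset midpoint_in_closed_segment by blast

lemma strictly_convex_on_midpoint:
  assumes "strictly_convex_on S f" "a \<in> S" "b \<in> S" "a \<noteq> b"
  shows "2 * f (midpoint a b) < f a + f b"
proof -
  have "f ((1 - 1/2) *\<^sub>R a + (1/2::real) *\<^sub>R b) < (1 - 1/2) * f a + 1/2 * f b"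
    using assms unfolding strictly_convex_on_def
    by (metis (no_types, opaque_lifting) half_gt_zero zero_less_one field_sum_of_halves less_add_same_cancel1)
  moreover have "midpoint a b = (1 - 1/2) *\<^sub>R a + (1/2::real) *\<^sub>R b"
    by (simp add: midpoint_def scaleR_add_right)
  ultimately show ?thesis by simp
qed

lemma strictly_convex_on_midpoint_le:
  assumes "strictly_convex_on S f" "a \<in> S" "b \<in> S"
  shows "2 * f (midpoint a b) \<le> f a + f b"
  using strictly_convex_on_midpoint[OF assms] by (cases "a = b") auto

text \<open>The midpoint gap of \<open>f\<close> is continuous and nonnegative on
  \<open>S \<times> S\<close> and vanishes only on the diagonal. Compactness thus stands in for a
  modulus of strong convexity.\<close>

lemma strictly_convex_on_tendsto:
  fixes f :: "'a::euclidean_space \<Rightarrow> real"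
  assumes S: "compact S" and f: "continuous_on S f" "strictly_convex_on S f"
    and ab: "\<And>t. a t \<in> S" "\<And>t. b t \<in> S"
    and lim: "((\<lambda>t. f (a t) + f (b t) - 2 * f (midpoint (a t) (b t))) \<longlongrightarrow> 0) Fl"
  shows "((\<lambda>t. a t - b t) \<longlongrightarrow> 0) Fl"
proof -
  define g where "g z = f (fst z) + f (snd z) - 2 * f (midpoint (fst z) (snd z))" for z
  have S': "convex S" using f by (simp add: strictly_convex_on_def)
  have "continuous_on (S \<times> S) (\<lambda>z. midpoint (fst z) (snd z))"
    by (auto simp: midpoint_def intro!: continuous_intros)
  then have g: "continuous_on (S \<times> S) g"
    unfolding g_def
    by (intro continuous_on_diff continuous_on_add continuous_on_mult continuous_on_const
        continuous_on_compose2[OF f(1)] continuous_on_fst continuous_on_snd continuous_on_id)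
       (auto intro: convex_midpoint[OF S'])
  have g_nonneg: "0 \<le> g z" if "z \<in> S \<times> S" for z
    using strictly_convex_on_midpoint_le[OF f(2), of "fst z" "snd z"] that by (auto simp: g_def)
  have g_eq_0: "norm (fst z - snd z) = 0" if "z \<in> S \<times> S" "g z = 0" for z
    using strictly_convex_on_midpoint[OF f(2), of "fst z" "snd z"] that
    by (cases "fst z = snd z") (auto simp: g_def)
  have "((\<lambda>t. norm (fst (a t, b t) - snd (a t, b t))) \<longlongrightarrow> 0) Fl"
  proof (rule compact_nonneg_tendsto_zero[OF compact_Times[OF S S] g _ g_nonneg _ g_eq_0])
    show "continuous_on (S \<times> S) (\<lambda>z. norm (fst z - snd z))" by (intro continuous_intros)
    show "((\<lambda>t. g (a t, b t)) \<longlongrightarrow> 0) Fl" using lim by (simp add: g_def)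
  qed (use ab in auto)
  then show ?thesis
    by (simp add: tendsto_norm_zero_iff)
qed


section \<open>Predictions\<close>

lemma predict_cong:
  "(\<And>j. j < i \<Longrightarrow> v j = w j) \<Longrightarrow> predict f x v i = predict f x w i"
  by (induction i) auto

lemma predict_shift:
  "predict f (f x (v 0)) (\<lambda>i. v (Suc i)) i = predict f x v (Suc i)"
  by (induction i) auto

text \<open>The candidate for the next problem: the first input is dropped, and \<open>us\<close>
  fills every position from \<open>K - 1\<close> on.\<close>

definition mpc_shift :: "nat \<Rightarrow> 'u \<Rightarrow> (nat \<Rightarrow> 'u) \<Rightarrow> nat \<Rightarrow> 'u" where
  "mpc_shift K us v i = (if Suc i < K then v (Suc i) else us)"

text \<open>Recursive feasibility: the old terminal state is a fixed point under \<open>us\<close>,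
  so the appended step stays in \<open>Xf\<close>.\<close>

lemma mpc_feasible_shift:
  assumes v: "mpc_feasible f X U Xf K x v" and "0 < K"
    and Xf: "Xf \<subseteq> X" "\<And>z. z \<in> Xf \<Longrightarrow> f z us = z" and us: "us \<in> U"
  shows "mpc_feasible f X U Xf K (f x (v 0)) (mpc_shift K us v)"
proof -
  obtain k where K: "K = Suc k" using \<open>0 < K\<close> gr0_conv_Suc by blast
  \<comment> \<open>Reaching position \<open>i < K\<close> uses only inputs of index at most
    \<open>K - 2\<close>, which precede the appended one.\<close>
  have p: "predict f (f x (v 0)) (mpc_shift K us v) i = predict f x v (Suc i)" if "i < K" for i
    unfolding predict_shift[symmetric] by (rule predict_cong) (use that in \<open>simp add: mpc_shift_def\<close>)
  have z: "predict f x v K \<in> Xf" using v by (simp add: mpc_feasible_def)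
  have "predict f (f x (v 0)) (mpc_shift K us v) K = predict f x v K"
    using Xf(2)[OF z] p[of k] by (simp add: K mpc_shift_def)
  moreover have "predict f x v (Suc i) \<in> X" if "i < K" for i
    using v z Xf(1) that by (cases "Suc i = K") (auto simp: mpc_feasible_def simp del: predict.simps)
  ultimately show ?thesis
    using v z us p by (simp add: mpc_feasible_def mpc_shift_def del: predict.simps)
qed

lemma sum_mpc_shift:
  fixes c :: "'u \<Rightarrow> real"
  assumes "0 < K"
  shows "(\<Sum>i<K. c (mpc_shift K us v i)) = (\<Sum>i<K. c (v i)) - c (v 0) + c us"
proof -
  obtain k where K: "K = Suc k" using \<open>0 < K\<close> gr0_conv_Suc by blast
  have "(\<Sum>i<K. c (v i)) = c (v 0) + (\<Sum>i<k. c (v (Suc i)))"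
    unfolding K by (rule sum.lessThan_Suc_shift)
  then show ?thesis by (simp add: K mpc_shift_def)
qed


section \<open>Affine systems with steady terminal states\<close>

text \<open>All that the convergence proof needs of the lifted system, apart from duality. Convexity
  of \<open>U\<close> is contained in strict convexity of \<open>c\<close>.\<close>

locale steady_mpc =
  fixes f :: "'x::euclidean_space \<Rightarrow> 'u::euclidean_space \<Rightarrow> 'x"
    and F G e and X :: "'x set" and U :: "'u set" and c :: "'u \<Rightarrow> real"
  assumes f_eq: "\<And>x u. f x u = F x + G u + e"
    and F: "bounded_linear F" and G: "bounded_linear G"
    and X: "compact X" "convex X" and U: "compact U"
    and c: "continuous_on U c" "strictly_convex_on U c"
    and solution: "\<exists>xs us. steady_solution f X U c xs us"
begin

abbreviation us :: 'u where "us \<equiv> steady_input f X U c"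
abbreviation vs :: real where "vs \<equiv> steady_value f X U c"
abbreviation Xs :: "'x set" where "Xs \<equiv> steady_states f X U c"

section \<open>Uniqueness of the steady input and shape of the steady set\<close>

lemma convex_U: "convex U"
  using c by (simp add: strictly_convex_on_def)

lemma f_midpoint: "f (midpoint x x') (midpoint u u') = midpoint (f x u) (f x' u')"
proof -
  interpret F: bounded_linear F by (fact F)
  interpret G: bounded_linear G by (fact G)
  have "e = (1/2::real) *\<^sub>R (e + e)" by (simp add: scaleR_half_double)
  then show ?thesis
    by (simp add: f_eq midpoint_def F.scaleR G.scaleR F.add G.add scaleR_add_right)
qed

lemma f_diff: "f x u - f x' u' = F (x - x') + G (u - u')"
  by (simp add: f_eq[of x] f_eq[of x'] bounded_linear.linear F G linear_diff)

lemma predict_midpoint: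
  "predict f x (\<lambda>i. midpoint (v i) (w i)) k = midpoint (predict f x v k) (predict f x w k)"
  by (induction k) (simp_all add: f_midpoint)

text \<open>Otherwise the midpoint of the two solutions would be feasible, as \<open>f\<close> is
  affine, and strictly cheaper. Only the input is determined; the steady state may vary.\<close>

lemma steady_solution_unique:
  assumes "steady_solution f X U c x u" "steady_solution f X U c x' u'"
  shows "u = u'"
proof (rule ccontr)
  assume ne: "u \<noteq> u'"
  have S: "x \<in> X" "x' \<in> X" "u \<in> U" "u' \<in> U" "f x u = x" "f x' u' = x'"
    using assms by (auto simp: steady_solution_def steady_feasible_def)
  then have "(midpoint x x', midpoint u u') \<in> steady_feasible f X U"
    by (simp add: steady_feasible_def f_midpoint convex_midpoint X convex_U)
  then have "c u \<le> c (midpoint u u')" "c u' \<le> c (midpoint u u')"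
    using assms by (auto simp: steady_solution_def)
  with strictly_convex_on_midpoint[OF c(2) S(3,4) ne] show False by simp
qed

lemma steady_solution_input: "\<exists>xs. steady_solution f X U c xs us"
proof -
  obtain xs u where "steady_solution f X U c xs u" using solution by blast
  then have "\<exists>!u. \<exists>x. steady_solution f X U c x u"
    using steady_solution_unique by blast
  then show ?thesis unfolding steady_input_def by (rule theI')
qed

lemma us_in_U: "us \<in> U"
  using steady_solution_input by (auto simp: steady_solution_def steady_feasible_def)

text \<open>The real infimum is attained, so it is a genuine minimum.\<close>

lemma vs_eq: "vs = c us"
proof -
  obtain xs where "steady_solution f X U c xs us" using steady_solution_input by blast
  then show ?thesis
    unfolding steady_value_def steady_solution_def
    by (intro cInf_eq_minimum) (force simp: image_iff)+
qed

lemma steady_set_eq: "steady_set f X U c = {x \<in> X. f x us = x} \<times> {us}"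
  by (auto simp: steady_set_def vs_eq us_in_U)

lemma Xs_eq: "Xs = {x \<in> X. f x us = x}"
  by (auto simp: steady_states_def steady_set_eq us_in_U)

section \<open>Closedness and convexity of the constraints, existence of optimal inputs\<close>

lemma continuous_f: "continuous_on S (\<lambda>z. f (g z) (h z))"
  if "continuous_on S g" "continuous_on S h"
  unfolding f_eq using that
  by (intro continuous_intros bounded_linear.continuous_on[OF F] bounded_linear.continuous_on[OF G])

lemma closed_Xs: "closed Xs"
proof -
  have "closed {x. f x us = x}"
    by (intro closed_Collect_eq continuous_f continuous_intros)
  then have "closed (X \<inter> {x. f x us = x})"
    using compact_imp_closed[OF X(1)] by (rule closed_Int[rotated])
  then show ?thesis by (simp add: Xs_eq Int_def)
qed

lemma midpoint_Xs: "x \<in> Xs \<Longrightarrow> x' \<in> Xs \<Longrightarrow> midpoint x x' \<in> Xs"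
  using f_midpoint[of x x' us us] by (auto simp: Xs_eq convex_midpoint X)

lemma mpc_feasible_midpoint:
  assumes "mpc_feasible f X U Xs K x v" "mpc_feasible f X U Xs K x w"
  shows "mpc_feasible f X U Xs K x (\<lambda>i. midpoint (v i) (w i))"
  using assms
  by (simp add: mpc_feasible_def predict_midpoint convex_midpoint X convex_U midpoint_Xs)

lemma continuous_predict: "continuous_on S (\<lambda>v. predict f x v i)"
  by (induction i) (auto intro!: continuous_intros continuous_f
      continuous_on_subset[OF continuous_on_product_coordinates])

text \<open>Weierstrass in the product topology on input sequences: the constraints are closed
  conditions on finitely many coordinates, inside a compact product of copies of
  \<open>U\<close>.\<close>

lemma mpc_optimal_exists:
  assumes "mpc_feasible f X U Xs K x v"
  shows "\<exists>w. mpc_optimal f X U c Xs K x w"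
proof -
  define S where "S = {w \<in> Pi UNIV (\<lambda>_. U). mpc_feasible f X U Xs K x w}"
  define J where "J w = (\<Sum>i<K. c (w i))" for w
  \<comment> \<open>Feasibility says nothing about inputs from index \<open>K\<close> on. Resetting
    them to \<open>us\<close> brings any feasible sequence into the compact set \<open>S\<close> at
    equal cost.\<close>
  define cut where "cut w i = (if i < K then w i else us)" for w :: "nat \<Rightarrow> 'u" and i
  have cut: "cut w \<in> S \<and> J (cut w) = J w" if "mpc_feasible f X U Xs K x w" for w
  proof -
    have "predict f x (cut w) i = predict f x w i" if "i \<le> K" for i
      by (rule predict_cong) (use that in \<open>simp add: cut_def\<close>)
    then show ?thesis using that us_in_U
      by (auto simp: S_def mpc_feasible_def J_def cut_def)
  qed
  have "closed {w. w i \<in> U}" for i :: nat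
    using closed_vimage[OF compact_imp_closed[OF U] continuous_on_product_coordinates[of i]]
    by (simp add: vimage_def)
  then have "closed ((\<Inter>i<K. (\<lambda>w. predict f x w i) -` X \<inter> {w. w i \<in> U}) \<inter>
      (\<lambda>w. predict f x w K) -` Xs)"
    by (intro closed_Int closed_INT ballI closed_vimage continuous_predict closed_Xs
        compact_imp_closed[OF X(1)])
  moreover have "S = Pi UNIV (\<lambda>_. U) \<inter> ((\<Inter>i<K. (\<lambda>w. predict f x w i) -` X \<inter> {w. w i \<in> U}) \<inter>
      (\<lambda>w. predict f x w K) -` Xs)"
    by (auto simp: S_def mpc_feasible_def)
  ultimately have S: "compact S"
    using U by (simp add: compact_Int_closed compact_Pi_UNIV)
  have J: "continuous_on S J"
    unfolding J_def
    by (intro continuous_on_sum continuous_on_compose2[OF c(1)]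
        continuous_on_subset[OF continuous_on_product_coordinates]) (auto simp: S_def)
  have "S \<noteq> {}" using cut[OF assms] by blast
  then obtain w where w: "w \<in> S" "\<And>w'. w' \<in> S \<Longrightarrow> J w \<le> J w'"
    using continuous_attains_inf[OF S _ J] by blast
  have "J w \<le> J w'" if "mpc_feasible f X U Xs K x w'" for w'
    using w(2)[of "cut w'"] cut[OF that] by simp
  then have "mpc_optimal f X U c Xs K x w"
    using w(1) by (simp add: mpc_optimal_def J_def S_def)
  then show ?thesis by blast
qed

section \<open>Dissipativity and the closed loop\<close>

text \<open>Without a duality gap, the Lagrangian at a dual maximiser \<open>y\<close> is at least
  \<open>vs\<close> on all of \<open>X \<times> U\<close>. Rearranged, this is a dissipation
  inequality with supply rate \<open>c u - vs\<close>.\<close>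

lemma strong_duality_dissipation:
  assumes "steady_strong_duality f X U c"
  obtains y where "\<And>x u. x \<in> X \<Longrightarrow> u \<in> U \<Longrightarrow> vs + y \<bullet> f x u \<le> c u + y \<bullet> x"
proof -
  obtain y where y: "ereal vs = steady_dual_fun f X U c y"
    using assms unfolding steady_strong_duality_def by metis
  have "vs + y \<bullet> f x u \<le> c u + y \<bullet> x" if "x \<in> X" "u \<in> U" for x u
  proof -
    have "steady_dual_fun f X U c y \<le> (case (x, u) of (x, u) \<Rightarrow> ereal (c u + y \<bullet> (x - f x u)))"
      unfolding steady_dual_fun_def by (rule INF_lower) (use that in auto)
    then show ?thesis by (simp add: y[symmetric] inner_diff_right)
  qed
  then show thesis by (rule that)
qed

lemma closed_loop_optimal:
  assumes cl: "closed_loop f X U c Xs K x u" and feas: "mpc_feasible f X U Xs K (x 0) v0"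
    and K: "0 < K"
  obtains v where "\<And>t. mpc_optimal f X U c Xs K (x t) (v t)" "\<And>t. u t = v t 0"
proof -
  \<comment> \<open>\<open>closed_loop\<close> demands an optimal input only where an optimum
    exists; feasibility supplies one, and the shift then carries feasibility to the next
    state.\<close>
  have step: "\<exists>v. mpc_optimal f X U c Xs K (x t) v \<and> u t = v 0"
    if "mpc_feasible f X U Xs K (x t) v" for t v
    using cl mpc_optimal_exists[OF that] by (auto simp: closed_loop_def)
  have "\<exists>v. mpc_feasible f X U Xs K (x t) v" for t
  proof (induction t)
    case (Suc t)
    then obtain v where "mpc_optimal f X U c Xs K (x t) v" "u t = v 0" using step by blast
    then have "mpc_feasible f X U Xs K (f (x t) (u t)) (mpc_shift K us v)"
      using K us_in_U by (auto intro!: mpc_feasible_shift simp: mpc_optimal_def Xs_eq)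
    then show ?case using cl by (auto simp: closed_loop_def)
  qed (use feas in blast)
  then have "\<forall>t. \<exists>v. mpc_optimal f X U c Xs K (x t) v \<and> u t = v 0" using step by blast
  then show thesis using that by metis
qed

theorem closed_loop_convergence:
  assumes cl: "closed_loop f X U c Xs K x u" and feas: "mpc_feasible f X U Xs K (x 0) v0"
    and K: "0 < K" and dual: "steady_strong_duality f X U c"
  shows "(\<lambda>t. infdist (x t, u t) (steady_set f X U c)) \<longlonglongrightarrow> 0" "(\<lambda>t. c (u t)) \<longlonglongrightarrow> vs"
proof -
  obtain v where opt: "\<And>t. mpc_optimal f X U c Xs K (x t) (v t)" and u: "\<And>t. u t = v t 0"
    using closed_loop_optimal[OF cl feas K] by blast
  obtain y where y: "\<And>x u. x \<in> X \<Longrightarrow> u \<in> U \<Longrightarrow> vs + y \<bullet> f x u \<le> c u + y \<bullet> x"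
    using strong_duality_dissipation[OF dual] by blast
  have dyn: "x (Suc t) = f (x t) (u t)" for t using cl by (simp add: closed_loop_def)
  have feas_t: "mpc_feasible f X U Xs K (x t) (v t)" for t using opt by (simp add: mpc_optimal_def)
  have vU: "v t i \<in> U" if "i < K" for t i using feas_t that by (simp add: mpc_feasible_def)
  have xX: "x t \<in> X" for t using feas_t[of t] K by (auto simp: mpc_feasible_def)
  define J where "J w = (\<Sum>i<K. c (w i))" for w
  define w where "w t = mpc_shift K us (v t)" for t
  have w: "mpc_feasible f X U Xs K (x (Suc t)) (w t)" for t
    unfolding w_def dyn u
    by (rule mpc_feasible_shift[OF feas_t K _ _ us_in_U]) (auto simp: Xs_eq)
  have Jw: "J (w t) = J (v t) - c (u t) + vs" for t
    unfolding J_def w_def u vs_eq by (rule sum_mpc_shift[OF K])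
  have Jle: "J (v (Suc t)) \<le> J w'" if "mpc_feasible f X U Xs K (x (Suc t)) w'" for t w'
    using opt[of "Suc t"] that by (auto simp: mpc_optimal_def J_def)

  \<comment> \<open>The Lyapunov function: optimal cost plus storage.\<close>
  define W where "W t = J (v t) + y \<bullet> x t" for t
  \<comment> \<open>By \<open>Jw\<close>, the two sides differ exactly by the slack of the
    dissipation inequality at \<open>(x t, u t)\<close>.\<close>
  have gap: "J (w t) - J (v (Suc t)) \<le> W t - W (Suc t)" for t
    using y[OF xX vU[OF K], of t t] by (simp add: W_def Jw dyn u)
  have "W (Suc t) \<le> W t" for t using gap[of t] Jle[OF w, of t] by simp
  then have dec: "decseq W" by (simp add: decseq_Suc_iff)
  obtain C where C: "\<And>t. C \<le> W t"
  proof -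
    have "compact (c ` U)" using U c by (intro compact_continuous_image)
    then obtain b where b: "\<And>u. u \<in> U \<Longrightarrow> b \<le> c u"
      using compact_imp_bounded bounded_imp_bdd_below by (metis bdd_below.E imageI)
    obtain r where r: "\<And>x. x \<in> X \<Longrightarrow> norm x \<le> r"
      using compact_imp_bounded[OF X(1)] by (auto simp: bounded_iff)
    \<comment> \<open>\<open>b\<close> bounds each of the \<open>K\<close> stage costs;
      \<open>norm y * r\<close> bounds the storage term by Cauchy-Schwarz.\<close>
    have "K * b - norm y * r \<le> W t" for t
    proof -
      have "(\<Sum>i<K. b) \<le> J (v t)"
        unfolding J_def by (intro sum_mono b vU) simp
      moreover have "- (norm y * r) \<le> y \<bullet> x t"
        using Cauchy_Schwarz_ineq2[of y "x t"] mult_left_mono[OF r[OF xX[of t]], of "norm y"]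
        by simp
      ultimately show ?thesis by (simp add: W_def)
    qed
    then show thesis by (rule that)
  qed
  obtain W0 where "W \<longlonglongrightarrow> W0"
    using decseq_convergent[OF dec, of C] C by blast
  then have "(\<lambda>t. W t - W (Suc t)) \<longlonglongrightarrow> W0 - W0"
    by (intro tendsto_diff LIMSEQ_Suc)
  then have Wdiff: "(\<lambda>t. W t - W (Suc t)) \<longlonglongrightarrow> 0" by simp

  have wU: "w t i \<in> U" if "i < K" for t i using w that by (simp add: mpc_feasible_def)
  \<comment> \<open>The midpoint of the optimal and the shifted sequence is feasible, hence no
    cheaper than the optimum. So the summed midpoint gaps are at most the suboptimality of
    \<open>w t\<close>, which \<open>gap\<close> bounds by a null sequence.\<close>
  have close: "(\<lambda>t. v (Suc t) i - w t i) \<longlonglongrightarrow> 0" if i: "i < K" for i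
  proof -
    define g where
      "g t j = c (v (Suc t) j) + c (w t j) - 2 * c (midpoint (v (Suc t) j) (w t j))" for t j
    have g0: "0 \<le> g t j" if "j < K" for t j
      using strictly_convex_on_midpoint_le[OF c(2) vU[OF that] wU[OF that]] by (simp add: g_def)
    have "g t i \<le> W t - W (Suc t)" for t
    proof -
      have "g t i \<le> (\<Sum>j<K. g t j)" using i g0 by (intro member_le_sum) auto
      also have "\<dots> = J (v (Suc t)) + J (w t) - 2 * J (\<lambda>i. midpoint (v (Suc t) i) (w t i))"
        by (simp add: g_def J_def sum.distrib sum_subtractf sum_distrib_left)
      also have "\<dots> \<le> J (w t) - J (v (Suc t))"
        using Jle[OF mpc_feasible_midpoint[OF feas_t w], of t] by simp
      finally show ?thesis using gap[of t] by simp
    qed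
    then have "(\<lambda>t. g t i) \<longlonglongrightarrow> 0"
      using g0[OF i] by (intro tendsto_sandwich[OF _ _ tendsto_const Wdiff]) auto
    then show ?thesis
      unfolding g_def by (intro strictly_convex_on_tendsto[OF U c] vU wU i)
  qed
  have lim_step: "(\<lambda>t. v t i) \<longlonglongrightarrow> us" if "i < K" "(\<lambda>t. w t i) \<longlonglongrightarrow> us" for i
  proof -
    have "(\<lambda>t. v (Suc t) i) \<longlonglongrightarrow> us"
      using tendsto_add[OF close[OF that(1)] that(2)] by simp
    then show ?thesis by (rule LIMSEQ_imp_Suc)
  qed
  \<comment> \<open>Downward induction on the position: \<open>w t (K - 1)\<close> is constantly
    \<open>us\<close>, and for smaller \<open>i\<close> the entry \<open>w t i\<close> is
    \<open>v t (Suc i)\<close>, so the limit moves from \<open>Suc i\<close> to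
    \<open>i\<close>.\<close>
  have vlim: "(\<lambda>t. v t i) \<longlonglongrightarrow> us" if "i < K" for i
  proof -
    have "i \<le> K - 1" using that by simp
    then show ?thesis
    proof (induction rule: inc_induct)
      case base
      show ?case by (rule lim_step) (use K in \<open>auto simp: w_def mpc_shift_def\<close>)
    next
      case (step n)
      then have "Suc n < K" by simp
      then show ?case using step.IH by (intro lim_step) (simp_all add: w_def mpc_shift_def)
    qed
  qed
  have ulim: "u \<longlonglongrightarrow> us" unfolding u using vlim[OF K] .
  \<comment> \<open>Applied and predicted inputs share the limit \<open>us\<close>, so the
    prediction error stays a null sequence through each of the finitely many steps.\<close>
  have pred: "(\<lambda>t. x (t + i) - predict f (x t) (v t) i) \<longlonglongrightarrow> 0" if "i \<le> K" for i
    using that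
  proof (induction i)
    case (Suc i)
    have "(\<lambda>t. u (t + i) - v t i) \<longlonglongrightarrow> 0"
      using tendsto_diff[OF LIMSEQ_ignore_initial_segment[OF ulim] vlim] Suc.prems by force
    from bounded_linear.tendsto_zero[OF G this] bounded_linear.tendsto_zero[OF F Suc.IH] Suc.prems
    have "(\<lambda>t. F (x (t + i) - predict f (x t) (v t) i) + G (u (t + i) - v t i)) \<longlonglongrightarrow> 0"
      by (simp add: tendsto_add_zero)
    then show ?case by (simp add: dyn f_diff)
  qed simp

  show "(\<lambda>t. c (u t)) \<longlonglongrightarrow> vs"
    unfolding vs_eq using vU[OF K]
    by (intro continuous_on_tendsto_compose[OF c(1) ulim us_in_U]) (simp add: u)
  \<comment> \<open>The terminal constraint makes \<open>z t\<close> steady, so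
    \<open>(z t, us)\<close> is a point of the steady set near the pair at time
    \<open>t + K\<close>. This point may move with \<open>t\<close>.\<close>
  define z where "z t = predict f (x t) (v t) K" for t
  have z: "(z t, us) \<in> steady_set f X U c" for t
    using feas_t[of t] by (auto simp: mpc_feasible_def z_def steady_set_eq Xs_eq)
  have "(\<lambda>t. (x (t + K) - z t, u (t + K) - us)) \<longlonglongrightarrow> (0, us - us)"
    using pred[of K] unfolding z_def
    by (intro tendsto_intros LIMSEQ_ignore_initial_segment ulim) auto
  then have "(\<lambda>t. dist (x (t + K), u (t + K)) (z t, us)) \<longlonglongrightarrow> 0"
    unfolding dist_norm by (simp add: tendsto_norm_zero_iff flip: zero_prod_def)
  then have "(\<lambda>t. infdist (x (t + K), u (t + K)) (steady_set f X U c)) \<longlonglongrightarrow> 0"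
    by (rule tendsto_sandwich[OF _ _ tendsto_const, rotated 2])
       (simp_all add: infdist_nonneg infdist_le[OF z])
  then show "(\<lambda>t. infdist (x t, u t) (steady_set f X U c)) \<longlonglongrightarrow> 0"
    by (rule LIMSEQ_offset)
qed

end


section \<open>Lifted constraint sets and costs\<close>

lemma block_linear: "linear (\<lambda>v. block v i)"
  by (rule linearI) (simp_all add: block_def vec_eq_iff)

text \<open>The continuous image under \<open>stack\<close> of a product of copies of
  \<open>S\<close>.\<close>

lemma compact_lift_set:
  fixes S :: "(real ^ 'n) set"
  assumes "compact S"
  shows "compact (lift_set S :: (real ^ ('t::finite \<times> 'n)) set)"
proof -
  have "lift_set S = (stack :: ('t \<Rightarrow> _) \<Rightarrow> _) ` Pi UNIV (\<lambda>_. S)"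
    by (auto simp: lift_set_def Pi_iff intro!: image_eqI[where f = stack and x = "block _"])
  moreover have "continuous_on A (stack :: ('t \<Rightarrow> real ^ 'n) \<Rightarrow> _)" for A
    unfolding stack_def
    by (intro continuous_intros continuous_on_subset[OF continuous_on_product_coordinates]) simp
  ultimately show ?thesis
    using assms by (simp add: compact_continuous_image compact_Pi_UNIV)
qed

lemma convex_lift_set:
  fixes S :: "(real ^ 'n) set"
  assumes "convex S"
  shows "convex (lift_set S :: (real ^ ('t::finite \<times> 'n)) set)"
  using assms unfolding convex_def lift_set_def
  by (auto simp: linear_add[OF block_linear] linear_scale[OF block_linear])

lemma continuous_on_lift_cost:
  fixes a :: "real ^ ('t::finite \<times> 'p::finite)"
  assumes "\<And>i. continuous_on U (l (block a i))"
  shows "continuous_on (lift_set U) (lift_cost l a)"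
proof -
  have "continuous_on A (\<lambda>v. block v i)" for A :: "(real ^ ('t \<times> 'n::finite)) set" and i
    using block_linear by (intro linear_continuous_on) (simp add: linear_conv_bounded_linear)
  then show ?thesis
    unfolding lift_cost_def
    by (intro continuous_on_sum continuous_on_compose2[OF assms]) (auto simp: lift_set_def)
qed

text \<open>Distinct stacked vectors differ in some block, which gives a strict inequality; every
  other block contributes at least a weak one.\<close>

lemma strictly_convex_on_lift_cost:
  fixes a :: "real ^ ('t::finite \<times> 'p::finite)" and U :: "(real ^ 'n) set"
  assumes U: "convex U" and l: "\<And>i. strictly_convex_on U (l (block a i))"
  shows "strictly_convex_on (lift_set U) (lift_cost l a)"
  unfolding strictly_convex_on_def
proof (intro conjI ballI allI impI)
  fix x y :: "real ^ ('t \<times> 'n)" and s :: real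
  assume xy: "x \<in> lift_set U" "y \<in> lift_set U" and s: "x \<noteq> y \<and> 0 < s \<and> s < 1"
  have bl: "block ((1 - s) *\<^sub>R x + s *\<^sub>R y) i = (1 - s) *\<^sub>R block x i + s *\<^sub>R block y i" for i
    by (simp add: linear_add[OF block_linear] linear_scale[OF block_linear])
  have U': "block x i \<in> U" "block y i \<in> U" for i using xy by (auto simp: lift_set_def)
  have lt: "l (block a i) ((1 - s) *\<^sub>R block x i + s *\<^sub>R block y i) <
      (1 - s) * l (block a i) (block x i) + s * l (block a i) (block y i)"
    if "block x i \<noteq> block y i" for i
    using l[of i] U'[of i] s that by (auto simp: strictly_convex_on_def)
  have le: "l (block a i) ((1 - s) *\<^sub>R block x i + s *\<^sub>R block y i) \<le>
      (1 - s) * l (block a i) (block x i) + s * l (block a i) (block y i)" for i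
  proof (cases "block x i = block y i")
    case True
    then show ?thesis by (simp add: algebra_simps flip: scaleR_add_left)
  qed (use lt in force)
  obtain i where "block x i \<noteq> block y i" using s by (metis stack_block ext)
  then have "(\<Sum>i\<in>UNIV. l (block a i) (block ((1 - s) *\<^sub>R x + s *\<^sub>R y) i)) <
      (\<Sum>i\<in>UNIV. (1 - s) * l (block a i) (block x i) + s * l (block a i) (block y i))"
    unfolding bl using lt le by (intro sum_strict_mono_ex1) auto
  then show "lift_cost l a ((1 - s) *\<^sub>R x + s *\<^sub>R y) < (1 - s) * lift_cost l a x + s * lift_cost l a y"
    by (simp add: lift_cost_def sum.distrib sum_distrib_left)
qed (rule convex_lift_set[OF U])

theorem corollary1:
  fixes A :: "real ^ 'n ^ 'n" and B :: "real ^ 'm ^ 'n" and Bd :: "real ^ 'd ^ 'n"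
    and X :: "(real ^ 'n) set" and U :: "(real ^ 'm) set"
    and d :: "nat \<Rightarrow> real ^ 'd"
    and \<alpha> :: "nat \<Rightarrow> real ^ 'p" and P :: "(real ^ 'p) set"
    and \<l> :: "real ^ 'p \<Rightarrow> real ^ 'm \<Rightarrow> real"
    and K :: nat
    and x :: "nat \<Rightarrow> real ^ ('t::{finite,linorder} \<times> 'n)"
    and u :: "nat \<Rightarrow> real ^ ('t \<times> 'm)"
  defines "f \<equiv> lift_step A B Bd (lift_signal d)"
    and "Xl \<equiv> lift_set X" and "Ul \<equiv> lift_set U"
    and "c \<equiv> lift_cost \<l> (lift_signal \<alpha>)"
  assumes "compact X" and "convex X" and "compact U" and "convex U"
    and "periodic CARD('t) d"
    and "periodic CARD('t) \<alpha>" and "range \<alpha> \<subseteq> P"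
    and "\<forall>a\<in>P. continuous_on U (\<l> a) \<and> strictly_convex_on U (\<l> a)"
    and "\<exists>xs us. steady_solution f Xl Ul c xs us"
    and "steady_strong_duality f Xl Ul c"
    and "K > 1"
    and "\<exists>v. mpc_feasible f Xl Ul (steady_states f Xl Ul c) K (x 0) v"
    and "closed_loop f Xl Ul c (steady_states f Xl Ul c) K x u"
  shows "((\<lambda>t. infdist (x t, u t) (steady_set f Xl Ul c)) \<longlonglongrightarrow> 0) \<and>
    ((\<lambda>t. c (u t)) \<longlonglongrightarrow> steady_value f Xl Ul c)"
proof -
  have a: "block (lift_signal \<alpha> :: real ^ ('t \<times> 'p)) i \<in> P" for i
    using assms by (auto simp: lift_signal_def)
  \<comment> \<open>In lifted time the disturbance is constant and becomes the offset
    \<open>e\<close> of the affine map.\<close>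
  interpret steady_mpc f "\<lambda>x. lift_A A *v x" "\<lambda>u. lift_B A B *v u"
      "lift_B A Bd *v lift_signal d" Xl Ul c
  proof (rule steady_mpc.intro)
    show "f x u = lift_A A *v x + lift_B A B *v u + lift_B A Bd *v lift_signal d" for x u
      by (simp add: f_def lift_step_def)
    show "bounded_linear (\<lambda>x. lift_A A *v x :: real ^ ('t \<times> 'n))"
      "bounded_linear (\<lambda>u. lift_B A B *v u :: real ^ ('t \<times> 'n))"
      by (rule matrix_vector_mul_bounded_linear)+
    show "compact Xl" "convex Xl" "compact Ul"
      using assms by (simp_all add: compact_lift_set convex_lift_set)
    show "continuous_on Ul c" "strictly_convex_on Ul c"
      unfolding Ul_def c_def using assms a
      by (auto intro!: continuous_on_lift_cost strictly_convex_on_lift_cost)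
  qed fact
  obtain v where "mpc_feasible f Xl Ul (steady_states f Xl Ul c) K (x 0) v"
    using assms by blast
  with closed_loop_convergence[of K x u v] show ?thesis using assms by simp
qed

end
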